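(* Fix $D\ge 1$ and constants $k_0,b_0>0$. Consider the $N$-vehicle formation whose information graph is a square $D$-dimensional lattice, i.e. the $n_1\times n_2\times\dots\times n_D$ lattice with $n_1-1=n_2=\dots=n_D$, with reference vehicles exactly at the nodes with $i_1=n_1-1$ (so $N=(n_1-1)^D$), with double-integrator vehicles and symmetric control (all proportional gains equal to $k_0$, all derivative gains equal to $b_0$). Then the closed-loop stability margin $S$, computed from the PDE model described in the context, satisfies $$S=\frac{\pi^2 k_0}{4b_0}\,\frac{1}{N^{2/D}}+O\!\left(\frac{1}{N^{4/D}}\right)\qquad\text{as } N\to\infty .$$
   Context: Vehicle model. The $n_1\times\dots\times n_D$ lattice is the graph with nodes $\vec i=(i_1,\dots,i_D)$, $i_d\in\{0,\dots,n_d-1\}$ (with $n_d\ge 2$), and an edge between two nodes iff their Euclidean distance is $1$; $\mathcal N_i$ is the set of neighbors of $i$. The nodes with $i_1=n_1-1$ are reference vehicles, which perfectly track their desired constant-velocity trajectories; the other $N=(n_1-1)n_2\cdots n_D$ nodes are real vehicles. Each position coordinate of vehicle $i$ obeys $\ddot p_i=u_i$ with $u_i=-\sum_{j\in\mathcal N_i}k_{(i,j)}(p_i-p_j-\Delta_{i,j})-b_i(\dot p_i-v^* )$, where $v^*$ is the desired velocity, $p_i^*$ is the desired trajectory of $i$, $\Delta_{i,j}=p_i^*-p_j^*$ is the (constant, mutually consistent) desired spacing, and the gains do not depend on the coordinate. With $\tilde p_i=p_i-p_i^*$ the closed loop is $\ddot{\tilde p}_i=-\sum_{j\in\mathcal N_i}k_{(i,j)}(\tilde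 p_i-\tilde p_j)-b_i\dot{\tilde p}_i$, with $\tilde p_i=0$ at reference nodes. Symmetric control: $k_{(i,j)}=k_0$ for all edges and $b_i=b_0$ for all $i$. PDE model under symmetric control. For $\tilde p:[0,1]^D\times[0,\infty)\to\mathbb R$, $$\Big(\frac{\partial^2}{\partial t^2}+b_0\frac{\partial}{\partial t}\Big)\tilde p=\sum_{d=1}^D\frac{k_0}{(n_d-1)^2}\frac{\partial^2\tilde p}{\partial x_d^2},$$ with boundary conditions $\tilde p=0$ on the face $x_1=1$, $\partial\tilde p/\partial x_1=0$ on the face $x_1=0$, and $\partial\tilde p/\partial x_d=0$ on the faces $x_d=0$ and $x_d=1$ for $d>1$. An eigenvalue of the PDE model is a complex number $s$ for which there is a nonzero function $\phi$ on $[0,1]^D$ satisfying the boundary conditions and $(s^2+b_0s)\phi=\sum_{d}\frac{k_0}{(n_d-1)^2}\partial^2_{x_d}\phi$. The least stable eigenvalue is the one closest to the imaginary axis, and the stability margin $S$ is the absolute value of its real part. *)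

theory Defs
  imports
    "HOL-Analysis.Analysis"
    "HOL-Library.Landau_Symbols"
    "HOL-Library.Going_To_Filter"
begin

text \<open>
  The dimension \<open>D\<close> is \<open>CARD('d)\<close>. The type \<open>'d\<close> indexes the coordinate axes, and a fixed but
  arbitrary element \<open>d1 :: 'd\<close> plays the role of the first axis, the only distinguished one.
  The side lengths of the lattice are given by \<open>n :: 'd \<Rightarrow> nat\<close>.
\<close>

definition lattice_nodes :: "('d \<Rightarrow> nat) \<Rightarrow> ('d \<Rightarrow> nat) set" where
  "lattice_nodes n = {i. \<forall>d. i d < n d}"

definition reference_nodes :: "'d \<Rightarrow> ('d \<Rightarrow> nat) \<Rightarrow> ('d \<Rightarrow> nat) set" where
  "reference_nodes d1 n = {i \<in> lattice_nodes n. i d1 = n d1 - 1}"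

definition num_vehicles :: "'d \<Rightarrow> ('d \<Rightarrow> nat) \<Rightarrow> nat" where
  "num_vehicles d1 n = card (lattice_nodes n - reference_nodes d1 n)"

definition square_lattice :: "'d \<Rightarrow> ('d \<Rightarrow> nat) \<Rightarrow> bool" where
  "square_lattice d1 n \<longleftrightarrow> (\<forall>d. n d \<ge> 2) \<and> (\<forall>d. d \<noteq> d1 \<longrightarrow> n d = n d1 - 1)"

abbreviation unit_cube :: "(real ^ 'd) set" where
  "unit_cube \<equiv> cbox 0 1"

text \<open>
  Partial derivatives on the closed cube: the difference quotient only uses points of the cube, so
  the derivative is one-sided in direction \<open>d\<close> on the faces \<open>x $ d = 0\<close> and \<open>x $ d = 1\<close>.
\<close>

definition axis_slice :: "'d \<Rightarrow> real ^ 'd \<Rightarrow> real set" where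
  "axis_slice d x = {t. x + t *\<^sub>R axis d 1 \<in> unit_cube}"

definition partially_differentiable :: "'d \<Rightarrow> (real ^ 'd \<Rightarrow> complex) \<Rightarrow> real ^ 'd \<Rightarrow> bool" where
  "partially_differentiable d f x \<longleftrightarrow>
     (\<lambda>t. f (x + t *\<^sub>R axis d 1)) differentiable (at 0 within axis_slice d x)"

definition partial_deriv :: "'d \<Rightarrow> (real ^ 'd \<Rightarrow> complex) \<Rightarrow> real ^ 'd \<Rightarrow> complex" where
  "partial_deriv d f x =
     vector_derivative (\<lambda>t. f (x + t *\<^sub>R axis d 1)) (at 0 within axis_slice d x)"

primrec C_on_cube :: "nat \<Rightarrow> (real ^ 'd \<Rightarrow> complex) \<Rightarrow> bool" where
  "C_on_cube 0 f \<longleftrightarrow> continuous_on unit_cube f"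
| "C_on_cube (Suc k) f \<longleftrightarrow> continuous_on unit_cube f \<and>
     (\<forall>d. (\<forall>x\<in>unit_cube. partially_differentiable d f x) \<and> C_on_cube k (partial_deriv d f))"

definition boundary_conditions :: "'d::finite \<Rightarrow> (real ^ 'd \<Rightarrow> complex) \<Rightarrow> bool" where
  "boundary_conditions d1 \<phi> \<longleftrightarrow>
     (\<forall>x\<in>unit_cube. x $ d1 = 1 \<longrightarrow> \<phi> x = 0) \<and>
     (\<forall>x\<in>unit_cube. x $ d1 = 0 \<longrightarrow> partial_deriv d1 \<phi> x = 0) \<and>
     (\<forall>d. d \<noteq> d1 \<longrightarrow>
        (\<forall>x\<in>unit_cube. x $ d = 0 \<or> x $ d = 1 \<longrightarrow> partial_deriv d \<phi> x = 0))"

text \<open>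
  Eigenvalues of the PDE model under symmetric control, with classical (twice continuously
  differentiable up to the boundary), complex-valued eigenfunctions. Only the values of
  the eigenfunction on the cube matter, so it has to be nonzero somewhere on the cube.
\<close>

definition pde_eigenvalue :: "real \<Rightarrow> real \<Rightarrow> 'd::finite \<Rightarrow> ('d \<Rightarrow> nat) \<Rightarrow> complex \<Rightarrow> bool" where
  "pde_eigenvalue k0 b0 d1 n s \<longleftrightarrow>
     (\<exists>\<phi> :: real ^ 'd \<Rightarrow> complex.
        C_on_cube 2 \<phi> \<and>
        (\<exists>x\<in>unit_cube. \<phi> x \<noteq> 0) \<and>
        boundary_conditions d1 \<phi> \<and>
        (\<forall>x\<in>unit_cube. (s\<^sup>2 + of_real b0 * s) * \<phi> x =
           (\<Sum>d\<in>UNIV. of_real (k0 / (real (n d) - 1)\<^sup>2) * partial_deriv d (partial_deriv d \<phi>) x)))"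

definition least_stable_eigenvalue :: "real \<Rightarrow> real \<Rightarrow> 'd::finite \<Rightarrow> ('d \<Rightarrow> nat) \<Rightarrow> complex \<Rightarrow> bool" where
  "least_stable_eigenvalue k0 b0 d1 n s \<longleftrightarrow>
     pde_eigenvalue k0 b0 d1 n s \<and>
     (\<forall>s'. pde_eigenvalue k0 b0 d1 n s' \<longrightarrow> \<bar>Re s\<bar> \<le> \<bar>Re s'\<bar>)"

text \<open>
  There may be several least stable eigenvalues, but they all have the same \<open>\<bar>Re s\<bar>\<close>.
\<close>

definition stability_margin :: "real \<Rightarrow> real \<Rightarrow> 'd::finite \<Rightarrow> ('d \<Rightarrow> nat) \<Rightarrow> real" where
  "stability_margin k0 b0 d1 n =
     (THE S. \<exists>s. least_stable_eigenvalue k0 b0 d1 n s \<and> S = \<bar>Re s\<bar>)"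

end

theory Submission
  imports Defs
begin

text \<open>
  Put \<open>\<mu> = s\<^sup>2 + b\<^sub>0 s\<close>. Multiplying the eigenvalue equation by the conjugate of \<open>\<phi>\<close> and integrating by
  parts along each axis shows that \<open>\<mu>\<close> is real and that \<open>- \<mu>\<close> is at least the part of the Dirichlet
  energy belonging to the first axis. As \<open>\<phi>\<close> vanishes on the face \<open>x\<^sub>1 = 1\<close>, Wirtinger's inequality
  gives \<open>- \<mu> \<ge> l\<close> with \<open>l = \<pi>\<^sup>2 k\<^sub>0 / (4 m\<^sup>2)\<close>, \<open>m = n\<^sub>1 - 1\<close>, and \<open>cos (\<pi> x\<^sub>1 / 2)\<close> attains equality.
  For \<open>4 l \<le> b\<^sub>0\<^sup>2\<close> the stability margin is therefore the smaller root of \<open>x\<^sup>2 - b\<^sub>0 x + l\<close>, which is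
  \<open>l / b\<^sub>0 + O(l\<^sup>2)\<close>, and \<open>N = m\<^sup>D\<close>.
\<close>

subsection \<open>Iterated integrals over the unit cube\<close>

text \<open>Lines parallel to an axis are parametrized by the absolute coordinate \<open>t\<close>,
  not by the offset of \<open>axis_slice\<close>, so that each of them meets the cube in the same
  interval \<open>{0..1}\<close>.\<close>

definition coord_update :: "real ^ 'd \<Rightarrow> 'd \<Rightarrow> real \<Rightarrow> real ^ 'd" where
  "coord_update x d t = (\<chi> i. if i = d then t else x $ i)"

lemma coord_update_nth: "coord_update x d t $ i = (if i = d then t else x $ i)"
  by (simp add: coord_update_def)

lemma coord_update_same [simp]: "coord_update x d (x $ d) = x"
  by (simp add: coord_update_def vec_eq_iff)

lemma coord_update_commute:
  "d \<noteq> e \<Longrightarrow> coord_update (coord_update x d t) e u = coord_update (coord_update x e u) d t"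
  by (simp add: coord_update_def vec_eq_iff)

lemma coord_update_eq_add: "coord_update x d t = x + (t - x $ d) *\<^sub>R axis d 1"
  by (simp add: coord_update_def vec_eq_iff axis_def)

lemma coord_update_add_axis:
  "coord_update x d t + h *\<^sub>R axis d 1 = coord_update x d (t + h)"
  by (simp add: coord_update_def vec_eq_iff axis_def)

lemma mem_unit_cube: "x \<in> unit_cube \<longleftrightarrow> (\<forall>i. 0 \<le> x $ i \<and> x $ i \<le> 1)"
  by (simp add: mem_box_cart)

lemma coord_update_in_unit_cube:
  "x \<in> unit_cube \<Longrightarrow> 0 \<le> t \<Longrightarrow> t \<le> 1 \<Longrightarrow> coord_update x d t \<in> unit_cube"
  by (simp add: mem_unit_cube coord_update_nth)

lemma continuous_on_coord_update [continuous_intros]: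
  fixes f :: "'a::topological_space \<Rightarrow> real ^ 'd"
  assumes "continuous_on S f" "continuous_on S g"
  shows "continuous_on S (\<lambda>z. coord_update (f z) d (g z))"
  unfolding coord_update_eq_add using assms by (intro continuous_intros) auto

text \<open>The result is again a function on the cube, constant in direction \<open>d\<close>, so
  that integrations along different axes compose.\<close>

definition axis_integral :: "'d \<Rightarrow> (real ^ 'd \<Rightarrow> real) \<Rightarrow> real ^ 'd \<Rightarrow> real" where
  "axis_integral d g x = integral {0..1} (\<lambda>t. g (coord_update x d t))"

lemma continuous_on_axis_line:
  fixes g :: "real ^ 'd \<Rightarrow> 'b::topological_space"
  assumes "continuous_on unit_cube g" "x \<in> unit_cube"
  shows "continuous_on {0..1} (\<lambda>t. g (coord_update x d t))"
  by (rule continuous_on_compose2[OF assms(1)])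
     (auto intro!: continuous_intros coord_update_in_unit_cube assms(2))

lemma axis_line_integrable:
  fixes g :: "real ^ 'd \<Rightarrow> real"
  assumes "continuous_on unit_cube g" "x \<in> unit_cube"
  shows "(\<lambda>t. g (coord_update x d t)) integrable_on {0..1}"
  by (rule integrable_continuous_interval[OF continuous_on_axis_line[OF assms]])

lemma continuous_on_axis_integral:
  assumes "continuous_on unit_cube g"
  shows "continuous_on unit_cube (axis_integral d g)"
proof -
  have "continuous_on (unit_cube \<times> cbox 0 1) (\<lambda>(x, t). g (coord_update x d t))"
    unfolding case_prod_unfold
    by (rule continuous_on_compose2[OF assms])
       (auto intro!: continuous_intros coord_update_in_unit_cube)
  from integral_continuous_on_param[OF this] show ?thesis
    by (simp add: axis_integral_def[abs_def])
qed

text \<open>Fubini on a square for a continuous integrand; for \<open>d = e\<close> both sides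
  coincide.\<close>

lemma axis_integral_commute:
  assumes "continuous_on unit_cube g" "x \<in> unit_cube"
  shows "axis_integral d (axis_integral e g) x = axis_integral e (axis_integral d g) x"
proof (cases "d = e")
  case False
  have "continuous_on (cbox (0, 0) (1, 1))
          (\<lambda>(t, u). g (coord_update (coord_update x d t) e u))"
    unfolding case_prod_unfold
    by (rule continuous_on_compose2[OF assms(1)])
       (auto intro!: continuous_intros coord_update_in_unit_cube assms(2) simp: cbox_Pair_eq)
  from integral_swap_continuous[OF this] False show ?thesis
    by (simp add: axis_integral_def coord_update_commute[OF False])
qed simp

lemma axis_integral_cong:
  assumes "\<And>x. x \<in> unit_cube \<Longrightarrow> g x = h x" "x \<in> unit_cube"
  shows "axis_integral d g x = axis_integral d h x"
  unfolding axis_integral_def using assms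
  by (intro integral_cong) (auto intro: coord_update_in_unit_cube)

lemma axis_integral_nonneg:
  assumes "continuous_on unit_cube g" "\<And>x. x \<in> unit_cube \<Longrightarrow> g x \<ge> 0" "x \<in> unit_cube"
  shows "axis_integral d g x \<ge> 0"
  unfolding axis_integral_def using assms
  by (intro integral_nonneg axis_line_integrable) (auto intro: coord_update_in_unit_cube)

lemma axis_integral_add:
  assumes "continuous_on unit_cube g" "continuous_on unit_cube h" "x \<in> unit_cube"
  shows "axis_integral d (\<lambda>y. g y + h y) x = axis_integral d g x + axis_integral d h x"
  unfolding axis_integral_def using assms by (intro integral_add axis_line_integrable)

lemma axis_integral_cmult: "axis_integral d (\<lambda>y. c * g y) x = c * axis_integral d g x"
  by (simp add: axis_integral_def)

lemma axis_integral_eq_0D: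
  assumes cont: "continuous_on unit_cube g" and nonneg: "\<And>x. x \<in> unit_cube \<Longrightarrow> g x \<ge> 0"
    and x: "x \<in> unit_cube" and zero: "axis_integral d g x = 0"
  shows "g x = 0"
proof -
  \<comment> \<open>A continuous nonnegative function with zero integral vanishes on the whole line;
    the parameter \<open>x $ d\<close> gives back the point \<open>x\<close>.\<close>
  have "g (coord_update x d (x $ d)) = 0"
  proof (rule has_integral_0_cbox_imp_0[of 0 1 "\<lambda>t. g (coord_update x d t)"])
    show "continuous_on (cbox 0 1) (\<lambda>t. g (coord_update x d t))"
      using continuous_on_axis_line[OF cont x] by simp
    show "((\<lambda>t. g (coord_update x d t)) has_integral 0) (cbox 0 1)"
      using integrable_integral[OF axis_line_integrable[OF cont x, of d]] zero
      by (simp add: axis_integral_def)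
  qed (use x nonneg coord_update_in_unit_cube[OF x] in \<open>auto simp: mem_unit_cube\<close>)
  thus ?thesis by simp
qed

text \<open>If \<open>ds\<close> lists every axis, this is the integral over the cube and the point
  argument no longer matters. Repetitions in \<open>ds\<close> are harmless: a coordinate already
  integrated out is constant, and the interval has length 1.\<close>

primrec iterated_integral :: "'d list \<Rightarrow> (real ^ 'd \<Rightarrow> real) \<Rightarrow> real ^ 'd \<Rightarrow> real" where
  "iterated_integral [] g = g"
| "iterated_integral (d # ds) g = iterated_integral ds (axis_integral d g)"

lemma iterated_integral_cong:
  assumes "\<And>x. x \<in> unit_cube \<Longrightarrow> g x = h x" "x \<in> unit_cube"
  shows "iterated_integral ds g x = iterated_integral ds h x"
  using assms
proof (induction ds arbitrary: g h)
  case (Cons d ds)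
  show ?case
    by (simp, rule Cons.IH) (auto intro: axis_integral_cong Cons.prems)
qed simp

lemma iterated_integral_nonneg:
  assumes "continuous_on unit_cube g" "\<And>x. x \<in> unit_cube \<Longrightarrow> g x \<ge> 0" "x \<in> unit_cube"
  shows "iterated_integral ds g x \<ge> 0"
  using assms
proof (induction ds arbitrary: g)
  case (Cons d ds)
  show ?case
    by (simp, rule Cons.IH)
       (auto intro: axis_integral_nonneg continuous_on_axis_integral Cons.prems)
qed simp

lemma iterated_integral_add:
  assumes "continuous_on unit_cube g" "continuous_on unit_cube h" "x \<in> unit_cube"
  shows "iterated_integral ds (\<lambda>y. g y + h y) x
         = iterated_integral ds g x + iterated_integral ds h x"
  using assms
proof (induction ds arbitrary: g h)
  case (Cons d ds)
  have "iterated_integral ds (axis_integral d (\<lambda>y. g y + h y)) x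
        = iterated_integral ds (\<lambda>y. axis_integral d g y + axis_integral d h y) x"
    by (intro iterated_integral_cong axis_integral_add Cons.prems)
  thus ?case
    by (simp add: Cons.IH continuous_on_axis_integral Cons.prems)
qed simp

lemma iterated_integral_cmult:
  "iterated_integral ds (\<lambda>y. c * g y) x = c * iterated_integral ds g x"
  by (induction ds arbitrary: g) (simp_all add: axis_integral_cmult[abs_def])

lemma iterated_integral_sum:
  assumes "finite A" "\<And>a. a \<in> A \<Longrightarrow> continuous_on unit_cube (g a)" "x \<in> unit_cube"
  shows "iterated_integral ds (\<lambda>y. \<Sum>a\<in>A. g a y) x = (\<Sum>a\<in>A. iterated_integral ds (g a) x)"
  using assms
proof (induction A rule: finite_induct)
  case empty
  show ?case using iterated_integral_cmult[of ds 0] by simp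
next
  case (insert a A)
  thus ?case by (simp add: iterated_integral_add continuous_on_sum)
qed

text \<open>By Fubini's theorem the integration along axis \<open>d\<close> may be carried out first.\<close>

lemma iterated_integral_nonneg_if_axis_nonneg:
  assumes "continuous_on unit_cube g" "\<And>x. x \<in> unit_cube \<Longrightarrow> axis_integral d g x \<ge> 0"
    "d \<in> set ds" "x \<in> unit_cube"
  shows "iterated_integral ds g x \<ge> 0"
  using assms
proof (induction ds arbitrary: g)
  case (Cons e ds)
  show ?case
  proof (cases "d = e")
    case True
    thus ?thesis
      using Cons.prems by (auto intro!: iterated_integral_nonneg continuous_on_axis_integral)
  next
    case False
    have "axis_integral d (axis_integral e g) y \<ge> 0" if "y \<in> unit_cube" for y
      unfolding axis_integral_commute[OF Cons.prems(1) that, of d e]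
      by (rule axis_integral_nonneg) (use Cons.prems that continuous_on_axis_integral in auto)
    thus ?thesis
      using Cons.prems False by (auto intro!: Cons.IH continuous_on_axis_integral)
  qed
qed simp

text \<open>The preceding lemma is applied to \<open>g\<close> and to its negative.\<close>

lemma iterated_integral_eq_0_if_axis_eq_0:
  assumes "continuous_on unit_cube g" "\<And>x. x \<in> unit_cube \<Longrightarrow> axis_integral d g x = 0"
    "d \<in> set ds" "x \<in> unit_cube"
  shows "iterated_integral ds g x = 0"
proof -
  have "iterated_integral ds g x \<ge> 0"
    using assms by (intro iterated_integral_nonneg_if_axis_nonneg) auto
  moreover have "iterated_integral ds (\<lambda>y. - 1 * g y) x \<ge> 0"
    using assms
    by (intro iterated_integral_nonneg_if_axis_nonneg[of _ d] continuous_intros)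
       (auto simp only: axis_integral_cmult)
  ultimately show ?thesis by (simp only: iterated_integral_cmult)
qed

text \<open>The axes are peeled off one at a time: the induction hypothesis makes the innermost axis
  integral vanish everywhere, and then the one-dimensional fact applies.\<close>

lemma iterated_integral_eq_0D:
  assumes "continuous_on unit_cube g" "\<And>x. x \<in> unit_cube \<Longrightarrow> g x \<ge> 0"
    "\<And>x. x \<in> unit_cube \<Longrightarrow> iterated_integral ds g x = 0" "x \<in> unit_cube"
  shows "g x = 0"
  using assms
proof (induction ds arbitrary: g x)
  case (Cons d ds)
  have "axis_integral d g x = 0"
    by (rule Cons.IH) (use Cons.prems in
       \<open>auto intro: continuous_on_axis_integral axis_integral_nonneg\<close>)
  thus ?case using Cons.prems axis_integral_eq_0D by blast
qed simp

subsection \<open>Partial derivatives along axis-parallel lines\<close>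

lemma axis_slice_eq:
  assumes "x \<in> unit_cube"
  shows "axis_slice d x = {- (x $ d)..1 - x $ d}"
proof -
  have "x + t *\<^sub>R axis d 1 = coord_update x d (x $ d + t)" for t
    by (simp add: coord_update_eq_add)
  with assms show ?thesis
    by (force simp: axis_slice_def mem_unit_cube coord_update_nth split: if_splits)
qed

text \<open>Chain rule with a translation. It turns the derivative at offset 0 into one at parameter
  \<open>t\<close>, and keeps it one-sided at the ends because the slice is a translate of
  \<open>{0..1}\<close>.\<close>

lemma has_vector_derivative_axis_line:
  assumes "x \<in> unit_cube" "t \<in> {0..1}" "partially_differentiable d f (coord_update x d t)"
  shows "((\<lambda>t. f (coord_update x d t)) has_vector_derivative
           partial_deriv d f (coord_update x d t)) (at t within {0..1})"
proof -
  define y where "y = coord_update x d t"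
  have "y \<in> unit_cube" using assms coord_update_in_unit_cube by (auto simp: y_def)
  have slice: "axis_slice d y = (\<lambda>u. u - t) ` {0..1}"
    using axis_slice_eq[OF \<open>y \<in> unit_cube\<close>] by (simp add: y_def coord_update_nth image_diff_atLeastAtMost)
  \<comment> \<open>The base point 0 is written as \<open>t - t\<close> to match the chain
    rule.\<close>
  have "((\<lambda>h. f (y + h *\<^sub>R axis d 1)) has_vector_derivative partial_deriv d f y)
          (at (t - t) within (\<lambda>u. u - t) ` {0..1})"
    using assms(3) unfolding partially_differentiable_def partial_deriv_def y_def[symmetric]
    by (simp add: vector_derivative_works slice)
  moreover have "((\<lambda>u. u - t) has_vector_derivative 1) (at t within {0..1})"
    by (auto intro!: derivative_eq_intros)
  ultimately have "((\<lambda>h. f (y + h *\<^sub>R axis d 1)) \<circ> (\<lambda>u. u - t) has_vector_derivative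
                     1 *\<^sub>R partial_deriv d f y) (at t within {0..1})"
    by (intro vector_diff_chain_within)
  moreover have "(\<lambda>h. f (y + h *\<^sub>R axis d 1)) \<circ> (\<lambda>u. u - t) = (\<lambda>t. f (coord_update x d t))"
    by (simp add: y_def coord_update_add_axis o_def)
  ultimately show ?thesis by (simp add: y_def)
qed

lemma partial_derivI:
  assumes "x \<in> unit_cube"
    and "((\<lambda>t. f (coord_update x d t)) has_vector_derivative D) (at (x $ d) within {0..1})"
  shows "partially_differentiable d f x" "partial_deriv d f x = D"
proof -
  have slice: "(\<lambda>h. x $ d + h) ` axis_slice d x = {0..1}"
    by (simp add: axis_slice_eq[OF assms(1)])
  have "((\<lambda>h. x $ d + h) has_vector_derivative 1) (at 0 within axis_slice d x)"
    by (auto intro!: derivative_eq_intros)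
  from vector_diff_chain_within[OF this, of "\<lambda>t. f (coord_update x d t)" D] assms(2) slice
  have "((\<lambda>t. f (coord_update x d t)) \<circ> (\<lambda>h. x $ d + h) has_vector_derivative D)
          (at 0 within axis_slice d x)"
    by simp
  moreover have "(\<lambda>t. f (coord_update x d t)) \<circ> (\<lambda>h. x $ d + h) = (\<lambda>h. f (x + h *\<^sub>R axis d 1))"
    by (simp add: o_def coord_update_eq_add)
  ultimately have deriv: "((\<lambda>h. f (x + h *\<^sub>R axis d 1)) has_vector_derivative D)
                            (at 0 within axis_slice d x)" by simp
  then show "partially_differentiable d f x"
    unfolding partially_differentiable_def by (rule differentiableI_vector)
  \<comment> \<open>Uniqueness of the derivative requires 0 to be a limit point of the slice, which
    holds as the slice is an interval of length 1 containing 0.\<close>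
  have "at 0 within axis_slice d x \<noteq> bot"
  proof -
    have "0 \<in> {- (x $ d)..1 - x $ d}" "- (x $ d) < 1 - x $ d"
      using assms(1) by (auto simp: mem_unit_cube)
    thus ?thesis
      by (simp add: axis_slice_eq[OF assms(1)] trivial_limit_within islimpt_Icc)
  qed
  from vector_derivative_within[OF this deriv] show "partial_deriv d f x = D"
    by (simp add: partial_deriv_def)
qed

lemma C_on_cube_2D:
  assumes "C_on_cube 2 f"
  shows "continuous_on unit_cube f" "continuous_on unit_cube (partial_deriv d f)"
    "continuous_on unit_cube (partial_deriv d (partial_deriv d f))"
    "\<And>x. x \<in> unit_cube \<Longrightarrow> partially_differentiable d f x"
    "\<And>x. x \<in> unit_cube \<Longrightarrow> partially_differentiable d (partial_deriv d f) x"
  using assms by (auto simp: numeral_2_eq_2)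

subsection \<open>Wirtinger's inequality and Green's identity on an interval\<close>

text \<open>
  Write \<open>f'\<^sup>2 - a\<^sup>2 f\<^sup>2\<close> as the square of \<open>f' + a tan (a t) f\<close> minus the derivative of
  \<open>a tan (a t) f\<^sup>2\<close>, which is regular on the whole interval for \<open>a < pi / 2\<close>.
\<close>

lemma wirtinger_inequality_aux:
  fixes f :: "real \<Rightarrow> real"
  assumes deriv: "\<And>t. t \<in> {0..1} \<Longrightarrow> (f has_real_derivative f' t) (at t within {0..1})"
    and cont: "continuous_on {0..1} f'" and "f 1 = 0" and a: "0 < a" "a < pi / 2"
  shows "a\<^sup>2 * integral {0..1} (\<lambda>t. (f t)\<^sup>2) \<le> integral {0..1} (\<lambda>t. (f' t)\<^sup>2)"
proof -
  have cos: "cos (a * t) > 0" if "t \<in> {0..1}" for t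
  proof (rule cos_gt_zero_pi)
    have "a * t \<le> a * 1" "0 \<le> a * t" using that a by (intro mult_left_mono, auto)
    thus "- (pi / 2) < a * t" "a * t < pi / 2" using a by linarith+
  qed
  have contf: "continuous_on {0..1} f"
    using deriv DERIV_continuous_on by blast
  define P' where "P' = (\<lambda>t. a\<^sup>2 * (1 + (tan (a * t))\<^sup>2) * (f t)\<^sup>2 + 2 * a * tan (a * t) * f t * f' t)"
  have "(P' has_integral a * tan (a * 1) * (f 1)\<^sup>2 - a * tan (a * 0) * (f 0)\<^sup>2) {0..1}"
  proof (rule fundamental_theorem_of_calculus)
    fix t :: real assume t: "t \<in> {0..1}"
    define T where "T = (\<lambda>t. tan (a * t))"
    have "((\<lambda>t. tan (a * t)) has_real_derivative inverse ((cos (a * t))\<^sup>2) * a) (at t within {0..1})"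
      using cos[OF t] by (auto intro!: derivative_eq_intros)
    moreover have "inverse ((cos (a * t))\<^sup>2) = 1 + (tan (a * t))\<^sup>2"
      using tan_sec[of "a * t"] cos[OF t] by (simp add: power_inverse)
    ultimately have "(T has_real_derivative (1 + (T t)\<^sup>2) * a) (at t within {0..1})"
      by (simp add: T_def)
    moreover have "P' t = a\<^sup>2 * (1 + (T t)\<^sup>2) * (f t)\<^sup>2 + 2 * a * T t * f t * f' t"
      by (simp add: P'_def T_def)
    ultimately have "((\<lambda>t. a * T t * (f t)\<^sup>2) has_real_derivative P' t) (at t within {0..1})"
      using deriv[OF t]
      by (auto intro!: derivative_eq_intros simp: algebra_simps power2_eq_square)
    hence "((\<lambda>t. a * tan (a * t) * (f t)\<^sup>2) has_real_derivative P' t) (at t within {0..1})"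
      by (simp add: T_def)
    thus "((\<lambda>t. a * tan (a * t) * (f t)\<^sup>2) has_vector_derivative P' t) (at t within {0..1})"
      by (simp add: has_real_derivative_iff_has_vector_derivative)
  qed simp
  \<comment> \<open>The boundary term vanishes at 1 because \<open>f 1 = 0\<close> and at 0 because
    \<open>tan 0 = 0\<close>.\<close>
  hence P': "(P' has_integral 0) {0..1}" using \<open>f 1 = 0\<close> by simp
  have f2: "(\<lambda>t. (f t)\<^sup>2) integrable_on {0..1}" "(\<lambda>t. (f' t)\<^sup>2) integrable_on {0..1}"
    by (intro integrable_continuous_interval continuous_intros contf cont)+
  have "((\<lambda>t. (f' t)\<^sup>2 - a\<^sup>2 * (f t)\<^sup>2 + P' t) has_integral
          integral {0..1} (\<lambda>t. (f' t)\<^sup>2) - a\<^sup>2 * integral {0..1} (\<lambda>t. (f t)\<^sup>2) + 0) {0..1}"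
    by (intro has_integral_add has_integral_diff has_integral_mult_right P' integrable_integral f2)
  moreover have "(f' t)\<^sup>2 - a\<^sup>2 * (f t)\<^sup>2 + P' t \<ge> 0" for t
  proof -
    have "(f' t)\<^sup>2 - a\<^sup>2 * (f t)\<^sup>2 + P' t = (f' t + a * tan (a * t) * f t)\<^sup>2"
      by (simp add: P'_def algebra_simps power2_eq_square)
    thus ?thesis by simp
  qed
  ultimately have "0 \<le> integral {0..1} (\<lambda>t. (f' t)\<^sup>2) - a\<^sup>2 * integral {0..1} (\<lambda>t. (f t)\<^sup>2) + 0"
    by (rule has_integral_nonneg)
  thus ?thesis by simp
qed

text \<open>At \<open>a = pi / 2\<close> the tangent blows up at \<open>t = 1\<close>, so the sharp
  constant is reached as a limit from the left.\<close>

lemma wirtinger_inequality: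
  fixes f :: "real \<Rightarrow> real"
  assumes "\<And>t. t \<in> {0..1} \<Longrightarrow> (f has_real_derivative f' t) (at t within {0..1})"
    and "continuous_on {0..1} f'" and "f 1 = 0"
  shows "pi\<^sup>2 / 4 * integral {0..1} (\<lambda>t. (f t)\<^sup>2) \<le> integral {0..1} (\<lambda>t. (f' t)\<^sup>2)"
proof -
  have "((\<lambda>a. a\<^sup>2 * integral {0..1} (\<lambda>t. (f t)\<^sup>2)) \<longlongrightarrow>
          (pi / 2)\<^sup>2 * integral {0..1} (\<lambda>t. (f t)\<^sup>2)) (at_left (pi / 2))"
    by (intro tendsto_intros)
  moreover have "eventually (\<lambda>a. a\<^sup>2 * integral {0..1} (\<lambda>t. (f t)\<^sup>2)
      \<le> integral {0..1} (\<lambda>t. (f' t)\<^sup>2)) (at_left (pi / 2))"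
    using eventually_at_left_real[OF pi_half_gt_zero]
    by eventually_elim (auto intro: wirtinger_inequality_aux assms)
  ultimately have "(pi / 2)\<^sup>2 * integral {0..1} (\<lambda>t. (f t)\<^sup>2) \<le> integral {0..1} (\<lambda>t. (f' t)\<^sup>2)"
    by (rule tendsto_upperbound) simp
  thus ?thesis by (simp add: power_divide)
qed

text \<open>Add the real inequalities for the real and imaginary parts.\<close>

lemma wirtinger_inequality_complex:
  fixes f :: "real \<Rightarrow> complex"
  assumes deriv: "\<And>t. t \<in> {0..1} \<Longrightarrow> (f has_vector_derivative f' t) (at t within {0..1})"
    and cont: "continuous_on {0..1} f'" and "f 1 = 0"
  shows "pi\<^sup>2 / 4 * integral {0..1} (\<lambda>t. (cmod (f t))\<^sup>2) \<le> integral {0..1} (\<lambda>t. (cmod (f' t))\<^sup>2)"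
proof -
  have contf: "continuous_on {0..1} f"
    using deriv has_vector_derivative_continuous continuous_on_eq_continuous_within by blast
  have "pi\<^sup>2 / 4 * integral {0..1} (\<lambda>t. (Re (f t))\<^sup>2) \<le> integral {0..1} (\<lambda>t. (Re (f' t))\<^sup>2)"
    using assms by (intro wirtinger_inequality continuous_intros)
      (auto simp: has_real_derivative_iff_has_vector_derivative
            intro!: bounded_linear.has_vector_derivative[OF bounded_linear_Re])
  moreover have "pi\<^sup>2 / 4 * integral {0..1} (\<lambda>t. (Im (f t))\<^sup>2) \<le> integral {0..1} (\<lambda>t. (Im (f' t))\<^sup>2)"
    using assms by (intro wirtinger_inequality continuous_intros)
      (auto simp: has_real_derivative_iff_has_vector_derivative
            intro!: bounded_linear.has_vector_derivative[OF bounded_linear_Im])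
  moreover have "integral {0..1} (\<lambda>t. (cmod (g t))\<^sup>2)
      = integral {0..1} (\<lambda>t. (Re (g t))\<^sup>2) + integral {0..1} (\<lambda>t. (Im (g t))\<^sup>2)"
    if "continuous_on {0..1} g" for g :: "real \<Rightarrow> complex"
    unfolding cmod_power2
    by (intro integral_add integrable_continuous_interval continuous_intros that)
  ultimately show ?thesis using cont contf by (simp add: algebra_simps)
qed

text \<open>The integrand is the derivative of \<open>cnj (f t) * f' t\<close>. The disjunctive
  hypotheses cover Dirichlet and Neumann ends alike: either one kills the boundary product.\<close>

lemma green_identity_interval:
  fixes f :: "real \<Rightarrow> complex"
  assumes deriv: "\<And>t. t \<in> {0..1} \<Longrightarrow> (f has_vector_derivative f' t) (at t within {0..1})"
    "\<And>t. t \<in> {0..1} \<Longrightarrow> (f' has_vector_derivative f'' t) (at t within {0..1})"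
    and bdry: "f 0 = 0 \<or> f' 0 = 0" "f 1 = 0 \<or> f' 1 = 0"
  shows "((\<lambda>t. cnj (f t) * f'' t + of_real ((cmod (f' t))\<^sup>2)) has_integral 0) {0..1}"
proof -
  have "((\<lambda>t. cnj (f t) * f'' t + cnj (f' t) * f' t) has_integral
          cnj (f 1) * f' 1 - cnj (f 0) * f' 0) {0..1}"
    by (intro fundamental_theorem_of_calculus has_vector_derivative_mult
          bounded_linear.has_vector_derivative[OF bounded_linear_cnj] deriv) auto
  moreover have "cnj z * z = of_real ((cmod z)\<^sup>2)" for z
    by (metis complex_norm_square mult.commute of_real_power)
  ultimately show ?thesis using bdry by auto
qed

subsection \<open>The spectral bound\<close>

text \<open>Brings all axes into the form required by Green's identity; the only Dirichlet end is
  parameter 1 on axis \<open>d1\<close>.\<close>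

lemma boundary_conditions_axis_line:
  assumes "boundary_conditions d1 \<phi>" "x \<in> unit_cube"
  shows "\<phi> (coord_update x d 0) = 0 \<or> partial_deriv d \<phi> (coord_update x d 0) = 0"
    "\<phi> (coord_update x d 1) = 0 \<or> partial_deriv d \<phi> (coord_update x d 1) = 0"
  using assms coord_update_in_unit_cube[OF assms(2), of 0 d]
    coord_update_in_unit_cube[OF assms(2), of 1 d]
  by (cases "d = d1"; simp add: boundary_conditions_def coord_update_nth)+

lemma green_identity_axis_line:
  assumes "C_on_cube 2 \<phi>" "boundary_conditions d1 \<phi>" "x \<in> unit_cube"
  shows "((\<lambda>t. cnj (\<phi> (coord_update x d t)) * partial_deriv d (partial_deriv d \<phi>) (coord_update x d t)
          + of_real ((cmod (partial_deriv d \<phi> (coord_update x d t)))\<^sup>2)) has_integral 0) {0..1}"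
  using assms
  by (intro green_identity_interval boundary_conditions_axis_line has_vector_derivative_axis_line)
     (auto intro: C_on_cube_2D coord_update_in_unit_cube)

lemma iterated_integral_green:
  assumes C2: "C_on_cube 2 \<phi>" and bc: "boundary_conditions d1 \<phi>"
    and d: "d \<in> set ds" and x: "x \<in> unit_cube"
  shows "iterated_integral ds (\<lambda>y. Re (cnj (\<phi> y) * partial_deriv d (partial_deriv d \<phi>) y)) x
         = - iterated_integral ds (\<lambda>y. (cmod (partial_deriv d \<phi> y))\<^sup>2) x"
    and "iterated_integral ds (\<lambda>y. Im (cnj (\<phi> y) * partial_deriv d (partial_deriv d \<phi>) y)) x = 0"
proof -
  note cont = C_on_cube_2D(1)[OF C2] C_on_cube_2D(2,3)[OF C2, of d]
  note green = green_identity_axis_line[OF C2 bc, of _ d]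
  have "iterated_integral ds (\<lambda>y. Re (cnj (\<phi> y) * partial_deriv d (partial_deriv d \<phi>) y)
          + (cmod (partial_deriv d \<phi> y))\<^sup>2) x = 0"
  proof (rule iterated_integral_eq_0_if_axis_eq_0[OF _ _ d x])
    fix y :: "real ^ 'a" assume "y \<in> unit_cube"
    from has_integral_linear[OF green[OF this] bounded_linear_Re]
    show "axis_integral d (\<lambda>y. Re (cnj (\<phi> y) * partial_deriv d (partial_deriv d \<phi>) y)
          + (cmod (partial_deriv d \<phi> y))\<^sup>2) y = 0"
      unfolding axis_integral_def
      by (intro integral_unique) (simp add: o_def flip: of_real_power)
  qed (intro continuous_intros cont)
  moreover have "iterated_integral ds (\<lambda>y. Re (cnj (\<phi> y) * partial_deriv d (partial_deriv d \<phi>) y)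
          + (cmod (partial_deriv d \<phi> y))\<^sup>2) x
      = iterated_integral ds (\<lambda>y. Re (cnj (\<phi> y) * partial_deriv d (partial_deriv d \<phi>) y)) x
        + iterated_integral ds (\<lambda>y. (cmod (partial_deriv d \<phi> y))\<^sup>2) x"
    by (intro iterated_integral_add x continuous_intros cont)
  ultimately show "iterated_integral ds (\<lambda>y. Re (cnj (\<phi> y) * partial_deriv d (partial_deriv d \<phi>) y)) x
         = - iterated_integral ds (\<lambda>y. (cmod (partial_deriv d \<phi> y))\<^sup>2) x"
    by linarith
  \<comment> \<open>The energy term in Green's identity is real and drops out of the imaginary
    part.\<close>
  show "iterated_integral ds (\<lambda>y. Im (cnj (\<phi> y) * partial_deriv d (partial_deriv d \<phi>) y)) x = 0"
  proof (rule iterated_integral_eq_0_if_axis_eq_0[OF _ _ d x])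
    fix y :: "real ^ 'a" assume "y \<in> unit_cube"
    from has_integral_linear[OF green[OF this] bounded_linear_Im]
    show "axis_integral d (\<lambda>y. Im (cnj (\<phi> y) * partial_deriv d (partial_deriv d \<phi>) y)) y = 0"
      unfolding axis_integral_def
      by (intro integral_unique) (simp add: o_def flip: of_real_power)
  qed (intro continuous_intros cont)
qed

lemma iterated_integral_wirtinger:
  assumes C2: "C_on_cube 2 \<phi>" and bc: "boundary_conditions d1 \<phi>"
    and d: "d1 \<in> set ds" and x: "x \<in> unit_cube"
  shows "pi\<^sup>2 / 4 * iterated_integral ds (\<lambda>y. (cmod (\<phi> y))\<^sup>2) x
         \<le> iterated_integral ds (\<lambda>y. (cmod (partial_deriv d1 \<phi> y))\<^sup>2) x"
proof -
  note cont = C_on_cube_2D(1)[OF C2] C_on_cube_2D(2)[OF C2, of d1]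
  \<comment> \<open>The difference is written as a sum with a negative factor, so that the rules for
    sums and scalar multiples split it.\<close>
  have "iterated_integral ds (\<lambda>y. (cmod (partial_deriv d1 \<phi> y))\<^sup>2
          + - (pi\<^sup>2 / 4) * (cmod (\<phi> y))\<^sup>2) x \<ge> 0"
  proof (rule iterated_integral_nonneg_if_axis_nonneg[OF _ _ d x])
    fix y :: "real ^ 'a" assume y: "y \<in> unit_cube"
    have "pi\<^sup>2 / 4 * integral {0..1} (\<lambda>t. (cmod (\<phi> (coord_update y d1 t)))\<^sup>2)
        \<le> integral {0..1} (\<lambda>t. (cmod (partial_deriv d1 \<phi> (coord_update y d1 t)))\<^sup>2)"
    proof (rule wirtinger_inequality_complex)
      show "\<phi> (coord_update y d1 1) = 0"
        using bc y by (simp add: boundary_conditions_def coord_update_in_unit_cube coord_update_nth)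
    qed (auto intro!: has_vector_derivative_axis_line continuous_on_axis_line y
           coord_update_in_unit_cube cont C_on_cube_2D(4)[OF C2])
    hence "axis_integral d1 (\<lambda>y. (cmod (partial_deriv d1 \<phi> y))\<^sup>2) y
            + - (pi\<^sup>2 / 4) * axis_integral d1 (\<lambda>y. (cmod (\<phi> y))\<^sup>2) y \<ge> 0"
      by (simp add: axis_integral_def)
    also have "axis_integral d1 (\<lambda>y. (cmod (partial_deriv d1 \<phi> y))\<^sup>2) y
            + - (pi\<^sup>2 / 4) * axis_integral d1 (\<lambda>y. (cmod (\<phi> y))\<^sup>2) y
        = axis_integral d1 (\<lambda>y. (cmod (partial_deriv d1 \<phi> y))\<^sup>2
            + - (pi\<^sup>2 / 4) * (cmod (\<phi> y))\<^sup>2) y"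
      unfolding axis_integral_cmult[symmetric]
      by (intro axis_integral_add[symmetric] y continuous_intros cont)
    finally show "axis_integral d1 (\<lambda>y. (cmod (partial_deriv d1 \<phi> y))\<^sup>2
            + - (pi\<^sup>2 / 4) * (cmod (\<phi> y))\<^sup>2) y \<ge> 0" .
  qed (intro continuous_intros cont)
  also have "iterated_integral ds (\<lambda>y. (cmod (partial_deriv d1 \<phi> y))\<^sup>2
          + - (pi\<^sup>2 / 4) * (cmod (\<phi> y))\<^sup>2) x
      = iterated_integral ds (\<lambda>y. (cmod (partial_deriv d1 \<phi> y))\<^sup>2) x
        + - (pi\<^sup>2 / 4) * iterated_integral ds (\<lambda>y. (cmod (\<phi> y))\<^sup>2) x"
    unfolding iterated_integral_cmult[symmetric]
    by (intro iterated_integral_add x continuous_intros cont)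
  finally show ?thesis by simp
qed

text \<open>Rayleigh quotient argument: with \<open>A\<close> the squared norm of the eigenfunction
  and \<open>B d\<close> its energy along axis \<open>d\<close>, testing the equation with
  \<open>cnj (\<phi> y)\<close> gives \<open>\<mu> * A = - (\<Sum>d. c d * B d)\<close>. The right
  side is real, and dropping the nonnegative terms of the other axes leaves the one controlled by
  Wirtinger.\<close>

lemma weighted_laplacian_eigenvalue_le:
  fixes \<phi> :: "real ^ 'd \<Rightarrow> complex" and c :: "'d \<Rightarrow> real" and \<mu> :: complex
  assumes C2: "C_on_cube 2 \<phi>" and nz: "\<exists>x\<in>unit_cube. \<phi> x \<noteq> 0"
    and bc: "boundary_conditions d1 \<phi>" and c: "\<And>d. c d \<ge> 0"
    and eq: "\<And>x. x \<in> unit_cube \<Longrightarrow>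
      \<mu> * \<phi> x = (\<Sum>d\<in>UNIV. of_real (c d) * partial_deriv d (partial_deriv d \<phi>) x)"
  shows "Im \<mu> = 0" "Re \<mu> \<le> - (c d1 * pi\<^sup>2 / 4)"
proof -
  obtain ds :: "'d list" where ds: "set ds = UNIV" using finite_list[OF finite] by blast
  note cont = C_on_cube_2D(1-3)[OF C2]
  define A where "A = iterated_integral ds (\<lambda>y. (cmod (\<phi> y))\<^sup>2)"
  define B where "B = (\<lambda>d. iterated_integral ds (\<lambda>y. (cmod (partial_deriv d \<phi> y))\<^sup>2))"
  \<comment> \<open>If the integral of the squared modulus were zero at every point argument, the
    eigenfunction would vanish on the cube.\<close>
  obtain x where x: "x \<in> unit_cube" "A x \<noteq> 0"
  proof (rule ccontr)
    assume "\<not> thesis"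
    hence "iterated_integral ds (\<lambda>y. (cmod (\<phi> y))\<^sup>2) x = 0" if "x \<in> unit_cube" for x
      using that \<open>\<And>x. x \<in> unit_cube \<Longrightarrow> A x \<noteq> 0 \<Longrightarrow> thesis\<close> by (auto simp: A_def)
    hence "(cmod (\<phi> x))\<^sup>2 = 0" if "x \<in> unit_cube" for x
      by (rule iterated_integral_eq_0D[rotated 2]) (use that cont in \<open>auto intro!: continuous_intros\<close>)
    with nz show False by auto
  qed
  have "A x \<ge> 0"
    unfolding A_def by (intro iterated_integral_nonneg x continuous_intros cont) auto
  with x have A: "A x > 0" by simp
  have B: "B d x \<ge> 0" for d
    unfolding B_def by (intro iterated_integral_nonneg x continuous_intros cont) auto
  have eq': "\<mu> * of_real ((cmod (\<phi> y))\<^sup>2)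
      = (\<Sum>d\<in>UNIV. of_real (c d) * (cnj (\<phi> y) * partial_deriv d (partial_deriv d \<phi>) y))"
    if "y \<in> unit_cube" for y
  proof -
    have "\<mu> * of_real ((cmod (\<phi> y))\<^sup>2) = cnj (\<phi> y) * (\<mu> * \<phi> y)"
      by (simp only: complex_norm_square mult_ac)
    thus ?thesis by (simp add: eq[OF that] sum_distrib_left mult_ac)
  qed
  have "Im \<mu> * A x = iterated_integral ds (\<lambda>y. Im \<mu> * (cmod (\<phi> y))\<^sup>2) x"
    by (simp add: A_def iterated_integral_cmult)
  also have "\<dots> = iterated_integral ds
      (\<lambda>y. \<Sum>d\<in>UNIV. c d * Im (cnj (\<phi> y) * partial_deriv d (partial_deriv d \<phi>) y)) x"
    using arg_cong[OF eq', of _ Im]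
    by (intro iterated_integral_cong x) (simp flip: of_real_power)
  also have "\<dots> = (\<Sum>d\<in>UNIV. c d * iterated_integral ds
      (\<lambda>y. Im (cnj (\<phi> y) * partial_deriv d (partial_deriv d \<phi>) y)) x)"
    unfolding iterated_integral_cmult[symmetric]
    by (intro iterated_integral_sum x continuous_intros cont) auto
  also have "\<dots> = 0"
    by (simp add: iterated_integral_green(2)[OF C2 bc _ x(1)] ds del: times_complex.sel)
  finally show "Im \<mu> = 0" using A by simp
  have "Re \<mu> * A x = iterated_integral ds (\<lambda>y. Re \<mu> * (cmod (\<phi> y))\<^sup>2) x"
    by (simp add: A_def iterated_integral_cmult)
  also have "\<dots> = iterated_integral ds
      (\<lambda>y. \<Sum>d\<in>UNIV. c d * Re (cnj (\<phi> y) * partial_deriv d (partial_deriv d \<phi>) y)) x"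
    using arg_cong[OF eq', of _ Re]
    by (intro iterated_integral_cong x) (simp flip: of_real_power)
  also have "\<dots> = (\<Sum>d\<in>UNIV. c d * iterated_integral ds
      (\<lambda>y. Re (cnj (\<phi> y) * partial_deriv d (partial_deriv d \<phi>) y)) x)"
    unfolding iterated_integral_cmult[symmetric]
    by (intro iterated_integral_sum x continuous_intros cont) auto
  also have "\<dots> = - (\<Sum>d\<in>UNIV. c d * B d x)"
    by (simp add: iterated_integral_green(1)[OF C2 bc _ x(1)] ds B_def sum_negf del: times_complex.sel)
  also have "\<dots> \<le> - (c d1 * B d1 x)"
    using member_le_sum[of d1 UNIV "\<lambda>d. c d * B d x"] B c by simp
  also have "\<dots> \<le> - (c d1 * (pi\<^sup>2 / 4 * A x))"
    using mult_left_mono[OF iterated_integral_wirtinger[OF C2 bc _ x(1), of ds] c[of d1]]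
    by (simp only: ds A_def B_def UNIV_I neg_le_iff_le)
  finally have "Re \<mu> * A x \<le> - (c d1 * pi\<^sup>2 / 4) * A x" by simp
  thus "Re \<mu> \<le> - (c d1 * pi\<^sup>2 / 4)" using A mult_le_cancel_right_pos by blast
qed

subsection \<open>The fundamental mode\<close>

text \<open>On a line along axis \<open>e\<close> the function is \<open>g\<close>, on a line along
  any other axis it is constant. Agreement on the cube suffices, since partial derivatives there
  only use points of the cube.\<close>

lemma partial_deriv_of_coordinate:
  fixes g g' :: "real \<Rightarrow> complex"
  assumes "x \<in> unit_cube" "\<And>x. x \<in> unit_cube \<Longrightarrow> f x = g (x $ e)"
    and "\<And>t. t \<in> {0..1} \<Longrightarrow> (g has_vector_derivative g' t) (at t within {0..1})"
  shows "partially_differentiable d f x"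
    "partial_deriv d f x = (if d = e then g' (x $ e) else 0)"
proof -
  have "((\<lambda>t. f (coord_update x d t)) has_vector_derivative (if d = e then g' (x $ e) else 0))
          (at (x $ d) within {0..1})"
  proof (rule has_vector_derivative_transform)
    show "x $ d \<in> {0..1}" using assms(1) by (simp add: mem_unit_cube)
    show "f (coord_update x d t) = (if d = e then g t else g (x $ e))" if "t \<in> {0..1}" for t
      using that assms(1,2) by (simp add: coord_update_in_unit_cube coord_update_nth)
    show "((\<lambda>t. if d = e then g t else g (x $ e)) has_vector_derivative
            (if d = e then g' (x $ e) else 0)) (at (x $ d) within {0..1})"
      using assms(1,3) by (auto simp: mem_unit_cube)
  qed
  from partial_derivI[OF assms(1) this]
  show "partially_differentiable d f x" "partial_deriv d f x = (if d = e then g' (x $ e) else 0)" .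
qed

lemma continuous_on_cube_of_coordinate:
  fixes g :: "real \<Rightarrow> complex"
  assumes "\<And>x. x \<in> unit_cube \<Longrightarrow> f x = g (x $ e)" "continuous_on {0..1} g"
  shows "continuous_on unit_cube f"
proof -
  have "continuous_on unit_cube (\<lambda>x :: real ^ 'a. g (x $ e))"
    by (rule continuous_on_compose2[OF assms(2)])
       (auto intro!: continuous_intros simp: mem_unit_cube)
  thus ?thesis using assms(1) continuous_on_cong by (metis (no_types, lifting))
qed

text \<open>The hypotheses on \<open>k\<close> quantify over all \<open>h\<close> with prescribed
  values on the cube, because \<open>partial_deriv d f\<close> is known only there.\<close>

lemma C_on_cube_Suc_of_coordinate:
  fixes g g' :: "real \<Rightarrow> complex"
  assumes eq: "\<And>x. x \<in> unit_cube \<Longrightarrow> f x = g (x $ e)"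
    and deriv: "\<And>t. t \<in> {0..1} \<Longrightarrow> (g has_vector_derivative g' t) (at t within {0..1})"
    and deriv_C: "\<And>h :: real ^ 'd \<Rightarrow> complex. (\<And>x. x \<in> unit_cube \<Longrightarrow> h x = g' (x $ e)) \<Longrightarrow> C_on_cube k h"
    and zero_C: "\<And>h :: real ^ 'd \<Rightarrow> complex. (\<And>x. x \<in> unit_cube \<Longrightarrow> h x = 0) \<Longrightarrow> C_on_cube k h"
  shows "C_on_cube (Suc k) f"
proof -
  have "continuous_on {0..1} g"
    using deriv has_vector_derivative_continuous continuous_on_eq_continuous_within by blast
  from continuous_on_cube_of_coordinate[of f g e, OF eq this]
  have "continuous_on unit_cube f" .
  moreover have "partially_differentiable d f x" if "x \<in> unit_cube" for x d
    using that eq deriv by (rule partial_deriv_of_coordinate(1)[where g = g])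
  moreover have pd: "partial_deriv d f x = (if d = e then g' (x $ e) else 0)"
    if "x \<in> unit_cube" for x d
    using that eq deriv by (rule partial_deriv_of_coordinate(2)[where g = g])
  moreover have "C_on_cube k (partial_deriv d f)" for d
  proof (cases "d = e")
    case True
    thus ?thesis by (intro deriv_C) (simp add: pd)
  next
    case False
    thus ?thesis by (intro zero_C) (simp add: pd)
  qed
  ultimately show ?thesis by simp
qed

lemma C_on_cube_zero:
  assumes "\<And>x :: real ^ 'd. x \<in> unit_cube \<Longrightarrow> f x = 0"
  shows "C_on_cube k f"
  using assms
proof (induction k arbitrary: f)
  case 0
  thus ?case using continuous_on_cube_of_coordinate[of f "\<lambda>_. 0"] by simp
next
  case (Suc k)
  show ?case
    \<comment> \<open>Any axis will do: the zero function is a function of each coordinate.\<close>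
    by (rule C_on_cube_Suc_of_coordinate[of f "\<lambda>_. 0" undefined "\<lambda>_. 0"])
       (use Suc in auto)
qed

text \<open>The mode \<open>cos (pi * x $ d1 / 2)\<close> is Neumann at 0, Dirichlet at 1 and
  constant along the other axes, so only the weight of axis \<open>d1\<close> enters.\<close>

lemma pde_eigenvalue_fundamental_mode:
  fixes d1 :: "'d::finite"
  assumes "s\<^sup>2 + of_real b0 * s = - of_real (k0 / (real (n d1) - 1)\<^sup>2 * pi\<^sup>2 / 4)"
  shows "pde_eigenvalue k0 b0 d1 n s"
proof -
  \<comment> \<open>The smallest positive frequency with \<open>cos w = 0\<close>.\<close>
  define w where "w = pi / 2"
  define g0 g1 g2 where "g0 = (\<lambda>t. complex_of_real (cos (w * t)))"
    and "g1 = (\<lambda>t. complex_of_real (- w * sin (w * t)))"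
    and "g2 = (\<lambda>t. complex_of_real (- w\<^sup>2 * cos (w * t)))"
  define \<phi> where "\<phi> = (\<lambda>x :: real ^ 'd. g0 (x $ d1))"
  have deriv: "(g0 has_vector_derivative g1 t) (at t within S)"
    "(g1 has_vector_derivative g2 t) (at t within S)" for t S
    unfolding g0_def g1_def g2_def
    by (intro has_vector_derivative_of_real;
        auto intro!: derivative_eq_intros simp: power2_eq_square
             simp flip: has_real_derivative_iff_has_vector_derivative)+
  have \<phi>: "\<phi> x = g0 (x $ d1)" for x by (simp add: \<phi>_def)
  have pd1: "partial_deriv d \<phi> x = (if d = d1 then g1 (x $ d1) else 0)" if "x \<in> unit_cube" for x d
    using that \<phi> deriv by (intro partial_deriv_of_coordinate)
  have pd2: "partial_deriv d (partial_deriv d \<phi>) x = (if d = d1 then g2 (x $ d1) else 0)"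
    if "x \<in> unit_cube" for x d
  proof (cases "d = d1")
    case True
    thus ?thesis using that pd1 deriv by (intro partial_deriv_of_coordinate) auto
  next
    case False
    \<comment> \<open>The first derivative is already zero on the cube in this direction.\<close>
    thus ?thesis
      using that partial_deriv_of_coordinate(2)[of x "partial_deriv d \<phi>" "\<lambda>_. 0" d1 "\<lambda>_. 0" d] pd1
      by simp
  qed
  have "C_on_cube (Suc (Suc 0)) \<phi>"
  proof (rule C_on_cube_Suc_of_coordinate[OF \<phi> deriv(1)])
    fix h :: "real ^ 'd \<Rightarrow> complex" assume h: "\<And>x. x \<in> unit_cube \<Longrightarrow> h x = g1 (x $ d1)"
    show "C_on_cube (Suc 0) h"
    proof (rule C_on_cube_Suc_of_coordinate[OF h deriv(2)])
      fix h :: "real ^ 'd \<Rightarrow> complex" assume h: "\<And>x. x \<in> unit_cube \<Longrightarrow> h x = g2 (x $ d1)"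
      thus "C_on_cube 0 h"
        using continuous_on_cube_of_coordinate[of h g2 d1] by (simp add: g2_def continuous_intros)
    qed (assumption, rule C_on_cube_zero)
  qed (rule C_on_cube_zero)
  hence "C_on_cube 2 \<phi>" by (simp only: numeral_2_eq_2)
  moreover have "\<exists>x\<in>unit_cube. \<phi> x \<noteq> 0"
    by (rule bexI[of _ 0]) (simp_all add: \<phi>_def g0_def mem_unit_cube)
  moreover have "boundary_conditions d1 \<phi>"
    by (auto simp: boundary_conditions_def pd1) (simp_all add: \<phi> g0_def g1_def w_def)
  moreover have "(s\<^sup>2 + of_real b0 * s) * \<phi> x =
       (\<Sum>d\<in>UNIV. of_real (k0 / (real (n d) - 1)\<^sup>2) * partial_deriv d (partial_deriv d \<phi>) x)"
    if "x \<in> unit_cube" for x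
  proof -
    have "(\<Sum>d\<in>UNIV. of_real (k0 / (real (n d) - 1)\<^sup>2) * partial_deriv d (partial_deriv d \<phi>) x)
        = of_real (k0 / (real (n d1) - 1)\<^sup>2) * g2 (x $ d1)"
      by (simp add: pd2[OF that] if_distrib[of "\<lambda>z. _ * z"] sum.delta' cong: if_cong)
    also have "\<dots> = - of_real (k0 / (real (n d1) - 1)\<^sup>2 * pi\<^sup>2 / 4) * \<phi> x"
      by (simp add: \<phi> g0_def g2_def w_def power_divide)
    finally show ?thesis using assms by simp
  qed
  ultimately show ?thesis unfolding pde_eigenvalue_def by blast
qed

lemma pde_eigenvalueD:
  assumes "pde_eigenvalue k0 b0 d1 n s" "k0 \<ge> 0"
  shows "Im (s\<^sup>2 + of_real b0 * s) = 0"
    "Re (s\<^sup>2 + of_real b0 * s) \<le> - (k0 / (real (n d1) - 1)\<^sup>2 * pi\<^sup>2 / 4)"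
proof -
  from assms(1) obtain \<phi> :: "real ^ 'a \<Rightarrow> complex" where \<phi>:
    "C_on_cube 2 \<phi>" "\<exists>x\<in>unit_cube. \<phi> x \<noteq> 0" "boundary_conditions d1 \<phi>"
    "\<And>x. x \<in> unit_cube \<Longrightarrow> (s\<^sup>2 + of_real b0 * s) * \<phi> x =
       (\<Sum>d\<in>UNIV. of_real (k0 / (real (n d) - 1)\<^sup>2) * partial_deriv d (partial_deriv d \<phi>) x)"
    unfolding pde_eigenvalue_def by blast
  from weighted_laplacian_eigenvalue_le[OF \<phi>(1-3) _ \<phi>(4)] assms(2)
  show "Im (s\<^sup>2 + of_real b0 * s) = 0"
    "Re (s\<^sup>2 + of_real b0 * s) \<le> - (k0 / (real (n d1) - 1)\<^sup>2 * pi\<^sup>2 / 4)"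
    by simp_all
qed

subsection \<open>The stability margin\<close>

text \<open>A number \<open>s\<close> for which \<open>s\<^sup>2 + b * s\<close> is real is either
  real or has real part \<open>- b / 2\<close>. In the first case completing the square confines
  \<open>2 * s + b\<close> to an interval of radius \<open>sqrt (b\<^sup>2 - 4 * l)\<close>; in the
  second \<open>b / 2\<close> exceeds the bound or equals it.\<close>

lemma abs_Re_root_ge:
  fixes s :: complex
  assumes "b > 0" "l \<ge> 0" "4 * l \<le> b\<^sup>2"
    and "Im (s\<^sup>2 + of_real b * s) = 0" "Re (s\<^sup>2 + of_real b * s) \<le> - l"
  shows "(b - sqrt (b\<^sup>2 - 4 * l)) / 2 \<le> \<bar>Re s\<bar>"
proof -
  define r where "r = sqrt (b\<^sup>2 - 4 * l)"
  have r: "r \<ge> 0" "r\<^sup>2 = b\<^sup>2 - 4 * l" using assms by (simp_all add: r_def)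
  have "Im s * (2 * Re s + b) = 0" using assms(4) by (simp add: power2_eq_square algebra_simps)
  then consider "Im s = 0" | "Re s = - b / 2" by fastforce
  hence "(b - r) / 2 \<le> \<bar>Re s\<bar>"
  proof cases
    case 1
    hence "(2 * Re s + b)\<^sup>2 \<le> r\<^sup>2"
      using assms(5) r by (simp add: power2_eq_square algebra_simps)
    hence "\<bar>2 * Re s + b\<bar> \<le> r" using r(1) by (simp add: abs_le_square_iff[symmetric])
    hence "2 * Re s + b \<le> r" by (simp add: abs_le_iff)
    thus ?thesis using abs_ge_minus_self[of "Re s"] by simp
  next
    case 2
    thus ?thesis using r(1) assms(1) by simp
  qed
  thus ?thesis by (simp add: r_def)
qed

text \<open>Under \<open>4 * l \<le> b0\<^sup>2\<close> the fundamental mode has real eigenvalues,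
  and the one nearer to 0 attains the lower bound of \<open>abs_Re_root_ge\<close>.\<close>

lemma stability_margin_eq:
  fixes d1 :: "'d::finite" and n :: "'d \<Rightarrow> nat" and k0 b0 :: real
  defines "l \<equiv> k0 / (real (n d1) - 1)\<^sup>2 * pi\<^sup>2 / 4"
  assumes "k0 > 0" "b0 > 0" "4 * l \<le> b0\<^sup>2"
  shows "stability_margin k0 b0 d1 n = (b0 - sqrt (b0\<^sup>2 - 4 * l)) / 2"
proof -
  define r where "r = sqrt (b0\<^sup>2 - 4 * l)"
  define s where "s = complex_of_real (- (b0 - r) / 2)"
  have l: "l \<ge> 0" using assms(2) by (simp add: l_def)
  have r: "r\<^sup>2 = b0\<^sup>2 - 4 * l" using assms(4) by (simp add: r_def)
  have "r \<le> b0" unfolding r_def using l assms(3) by (intro real_le_lsqrt) auto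
  have "s\<^sup>2 + of_real b0 * s = of_real ((r\<^sup>2 - b0\<^sup>2) / 4)"
    unfolding s_def of_real_power[symmetric] of_real_mult[symmetric] of_real_add[symmetric]
    by (simp add: power2_eq_square field_simps)
  also have "\<dots> = - of_real l" by (simp add: r)
  finally have ev: "pde_eigenvalue k0 b0 d1 n s"
    unfolding l_def by (rule pde_eigenvalue_fundamental_mode)
  have Re_s: "\<bar>Re s\<bar> = (b0 - r) / 2" using \<open>r \<le> b0\<close> by (simp add: s_def)
  have ge: "\<bar>Re s\<bar> \<le> \<bar>Re s'\<bar>" if "pde_eigenvalue k0 b0 d1 n s'" for s'
    using pde_eigenvalueD[OF that] assms(2-4) l
    by (simp only: Re_s r_def) (intro abs_Re_root_ge, auto simp: l_def)
  have "least_stable_eigenvalue k0 b0 d1 n s"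
    using ev ge by (auto simp: least_stable_eigenvalue_def)
  \<comment> \<open>Two least stable eigenvalues bound each other, so the described value is
    unique.\<close>
  hence "(THE S. \<exists>s. least_stable_eigenvalue k0 b0 d1 n s \<and> S = \<bar>Re s\<bar>) = \<bar>Re s\<bar>"
    by (intro the_equality) (auto simp: least_stable_eigenvalue_def intro: antisym)
  thus ?thesis by (simp add: stability_margin_def Re_s r_def)
qed

text \<open>For the smaller root \<open>x\<close> of \<open>x\<^sup>2 - b * x + l\<close> the error
  \<open>x - l / b\<close> is exactly \<open>x\<^sup>2 / b\<close>, and
  \<open>b - x \<ge> b / 2\<close> yields \<open>x \<le> 2 * l / b\<close>.\<close>

lemma small_root_expansion:
  fixes b l :: real
  assumes "b > 0" "l \<ge> 0" "4 * l \<le> b\<^sup>2"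
  shows "\<bar>(b - sqrt (b\<^sup>2 - 4 * l)) / 2 - l / b\<bar> \<le> 4 * l\<^sup>2 / b ^ 3"
proof -
  define r where "r = sqrt (b\<^sup>2 - 4 * l)"
  have r: "r \<ge> 0" "r\<^sup>2 = b\<^sup>2 - 4 * l" using assms by (simp_all add: r_def)
  define x where "x = (b - r) / 2"
  have x0: "x \<ge> 0"
    unfolding x_def r_def using assms by (auto intro!: real_le_lsqrt)
  have xb: "x \<le> b / 2" using r(1) by (simp add: x_def)
  have root: "x\<^sup>2 = b * x - l"
    using r(2) by (simp add: x_def power2_eq_square field_simps)
  have "x * (b / 2) \<le> x * (b - x)" using x0 xb by (intro mult_left_mono) auto
  also have "\<dots> = l" using root by (simp add: power2_eq_square algebra_simps)
  finally have "x \<le> 2 * l / b" using assms(1) by (simp add: field_simps)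
  hence "x\<^sup>2 \<le> (2 * l / b)\<^sup>2" using x0 by (intro power_mono)
  hence "x\<^sup>2 / b \<le> (2 * l / b)\<^sup>2 / b" using assms(1) by (intro divide_right_mono) auto
  moreover have "x - l / b = x\<^sup>2 / b" using root assms(1) by (simp add: field_simps)
  moreover have "(2 * l / b)\<^sup>2 / b = 4 * l\<^sup>2 / b ^ 3"
    using assms(1) by (simp add: power2_eq_square power3_eq_cube)
  ultimately show ?thesis
    using assms(1) by (simp add: x_def r_def[symmetric])
qed

text \<open>Removing the reference layer shortens axis \<open>d1\<close> by one, which makes all
  sides equal.\<close>

lemma num_vehicles_square_lattice:
  fixes d1 :: "'d::finite"
  assumes "square_lattice d1 n"
  shows "num_vehicles d1 n = (n d1 - 1) ^ CARD('d)"
proof -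
  have "lattice_nodes n - reference_nodes d1 n = PiE UNIV (\<lambda>_. {..<n d1 - 1})"
    (is "?L = ?R")
  proof (intro set_eqI)
    fix i
    have "i \<in> ?L \<longleftrightarrow> (\<forall>d. i d < n d) \<and> i d1 < n d1 - 1"
    proof -
      have "i d1 < n d1 - 1 \<longleftrightarrow> i d1 < n d1 \<and> i d1 \<noteq> n d1 - 1" by linarith
      thus ?thesis by (auto simp: lattice_nodes_def reference_nodes_def)
    qed
    also have "\<dots> \<longleftrightarrow> (\<forall>d. i d < n d1 - 1)"
    proof -
      have "n d = n d1 - 1" if "d \<noteq> d1" for d using assms that by (simp add: square_lattice_def)
      thus ?thesis by (metis diff_le_self order_less_le_trans)
    qed
    finally show "i \<in> ?L \<longleftrightarrow> i \<in> ?R" by (auto simp: PiE_UNIV_domain)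
  qed
  thus ?thesis by (simp add: num_vehicles_def card_PiE)
qed

theorem corollary1:
  fixes k0 b0 :: real and d1 :: "'d::finite"
  assumes "k0 > 0" and "b0 > 0"
  shows "(\<lambda>n. stability_margin k0 b0 d1 n
              - pi\<^sup>2 * k0 / (4 * b0) * (1 / real (num_vehicles d1 n) powr (2 / real CARD('d))))
         \<in> O[(num_vehicles d1) going_to at_top within {n. square_lattice d1 n}](\<lambda>n.
              1 / real (num_vehicles d1 n) powr (4 / real CARD('d)))"
proof -
  \<comment> \<open>For \<open>m \<ge> M\<close> one gets
    \<open>pi\<^sup>2 * k0 / b0\<^sup>2 \<le> m \<le> m\<^sup>2\<close>, that is
    \<open>4 * l \<le> b0\<^sup>2\<close>; the added 1 ensures \<open>m \<ge> 1\<close>.\<close>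
  define M where "M = nat \<lceil>pi\<^sup>2 * k0 / b0\<^sup>2\<rceil> + 1"
  \<comment> \<open>Inserting \<open>l = (pi\<^sup>2 * k0 / 4) / m\<^sup>2\<close> into the
    remainder \<open>4 * l\<^sup>2 / b0 ^ 3\<close> leaves \<open>C / m ^ 4\<close>.\<close>
  define C where "C = 4 * (pi\<^sup>2 * k0 / 4)\<^sup>2 / b0 ^ 3"
  have bound: "norm (stability_margin k0 b0 d1 n
              - pi\<^sup>2 * k0 / (4 * b0) * (1 / real (num_vehicles d1 n) powr (2 / real CARD('d))))
      \<le> C * norm (1 / real (num_vehicles d1 n) powr (4 / real CARD('d)))"
    if n: "square_lattice d1 n" and large: "num_vehicles d1 n \<ge> M ^ CARD('d)" for n
  proof -
    define m where "m = real (n d1) - 1"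
    define l where "l = k0 / m\<^sup>2 * pi\<^sup>2 / 4"
    have nm: "real (n d1 - 1) = m"
      using n by (auto simp: m_def square_lattice_def intro!: of_nat_diff elim: allE[of _ d1])
    have N: "num_vehicles d1 n = (n d1 - 1) ^ CARD('d)"
      by (rule num_vehicles_square_lattice[OF n])
    have "M \<le> n d1 - 1" using large unfolding N by (subst (asm) power_mono_iff) auto
    hence mM: "m \<ge> M" using nm by linarith
    hence m1: "m \<ge> 1" by (simp add: M_def)
    \<comment> \<open>As the number of vehicles is \<open>m ^ CARD('d)\<close>, the fractional
      powers in the claim become integer powers of \<open>m\<close>.\<close>
    have powr: "real (num_vehicles d1 n) powr (real k / real CARD('d)) = m ^ k" for k
    proof -
      have "real (num_vehicles d1 n) = m powr real CARD('d)"
        unfolding N of_nat_power nm using m1 by (simp add: powr_realpow)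
      thus ?thesis using m1 by (simp add: powr_powr flip: powr_realpow)
    qed
    have powr2: "real (num_vehicles d1 n) powr (2 / real CARD('d)) = m ^ 2"
      and powr4: "real (num_vehicles d1 n) powr (4 / real CARD('d)) = m ^ 4"
      using powr[of 2] powr[of 4] by simp_all
    have "pi\<^sup>2 * k0 / b0\<^sup>2 \<le> M" unfolding M_def by linarith
    also have "\<dots> \<le> m" by (rule mM)
    also have "\<dots> \<le> m\<^sup>2" using m1 by (simp add: self_le_power)
    finally have "4 * l \<le> b0\<^sup>2"
      using m1 assms(2) by (simp add: l_def field_simps)
    moreover have "l \<ge> 0" using assms(1) by (simp add: l_def)
    moreover have "stability_margin k0 b0 d1 n = (b0 - sqrt (b0\<^sup>2 - 4 * l)) / 2"
      using stability_margin_eq[OF assms, of n d1] \<open>4 * l \<le> b0\<^sup>2\<close>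
      by (simp only: l_def m_def)
    ultimately have "\<bar>stability_margin k0 b0 d1 n - l / b0\<bar> \<le> 4 * l\<^sup>2 / b0 ^ 3"
      using small_root_expansion[OF assms(2)] by metis
    moreover have "l / b0 = pi\<^sup>2 * k0 / (4 * b0) * (1 / m\<^sup>2)"
      by (simp add: l_def mult_ac)
    moreover have "4 * l\<^sup>2 / b0 ^ 3 = C * (1 / m ^ 4)"
      by (simp add: l_def C_def power_mult_distrib power_divide flip: power_mult)
    ultimately show ?thesis unfolding powr2 powr4 by simp
  qed
  show ?thesis
    \<comment> \<open>The filter asks for a threshold on the number of vehicles that is uniform over
      all square lattices; \<open>M ^ CARD('d)\<close> is one.\<close>
    by (rule bigoI[of _ C], unfold eventually_going_to_at_top_linorder,
        intro exI[of _ "M ^ CARD('d)"] ballI impI bound) simp_all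
qed

end
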